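(* Let $\epsilon=\max\{a_1,d-a_{k-1}\}$. Then: (1) $\left\lfloor\frac{F_1+F_2}{d}\right\rfloor\le a_1+(d-a_{k-1})-3$; (2) $\left\lfloor\frac{F_1+F_2}{d}\right\rfloor\le\epsilon-2$ if $i,i+1\in A_1$ for some $0\le i\le d-1$; (3) $\left\lfloor\frac{F_1+F_2}{d}\right\rfloor\le 0$ if $i,i+1,\dots,i+\epsilon-1\in A_1$ for some $0\le i\le d-\epsilon+1$.
   Context: Let $k\ge 3$, and let $0=:a_0<a_1<\cdots<a_k=:d$ be integers with $\gcd(a_1,\dots,a_k)=1$ and $k<d$. Put $A_1=\{0,a_1,\dots,a_k\}$, $A_2=\{d-a_i\mid 0\le i\le k\}$. For $i\in\{1,2\}$, $F_i$ is the Frobenius number of $A_i\setminus\{0\}$, i.e. the greatest integer not belonging to the submonoid of $\mathbb N$ generated by $A_i$ (so $F_i=-1$ if $1\in A_i$). *)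

theory Defs
  imports Complex_Main
begin

inductive_set generated_submonoid :: "nat set \<Rightarrow> nat set" for A :: "nat set" where
  zero: "0 \<in> generated_submonoid A"
| gen: "x \<in> A \<Longrightarrow> x \<in> generated_submonoid A"
| add: "x \<in> generated_submonoid A \<Longrightarrow> y \<in> generated_submonoid A
    \<Longrightarrow> x + y \<in> generated_submonoid A"

text \<open>
  The greatest element is taken over all integers, so the value is -1 when the generated
  submonoid is all of the natural numbers. It is meaningful only if the generated submonoid
  has finite complement in the natural numbers, i.e. if the greatest common divisor of
  the generators is 1.
\<close>

definition frobenius_number :: "nat set \<Rightarrow> int" where
  "frobenius_number A = (GREATEST z::int. z \<notin> int ` generated_submonoid A)"

end

theory Submission
  imports Defs "HOL-Number_Theory.Cong"
begin

text \<open>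
  All three parts come from bounding F1 and F2 separately. Part (1) is Schur's bound
  F \<le> (m - 1)(d - 1) - 1 for generators with least element m and greatest element d: sums of
  at most m - 1 generators already meet every residue class modulo m, since the set of classes
  met by sums of at most j generators grows strictly with j until it is everything.
  In the other two parts, m consecutive elements c, ..., c + m - 1 of the monoid force F < c.
  For part (2) the (m - 1)-fold sums of i and i + 1 form such a block for A1, and those of
  d - i - 1 and d - i one for A2; in part (3) the block lies in A1 and is reflected to A2.
\<close>

section \<open>Bounding the Frobenius number by consecutive elements of the monoid\<close>

lemma generated_submonoid_mult:
  "x \<in> generated_submonoid A \<Longrightarrow> n * x \<in> generated_submonoid A"
  by (induction n) (auto intro: generated_submonoid.intros)

text \<open>\<open>GREATEST\<close> says something only once a maximum is known to exist. The gaps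
  are bounded above by the hypothesis, and -1 is always a gap because the monoid consists of
  naturals, so a maximum exists.\<close>

lemma frobenius_number_less:
  assumes "\<And>n. n \<ge> c \<Longrightarrow> n \<in> generated_submonoid A"
  shows "frobenius_number A < int c"
proof -
  define G where "G = {z::int. z \<notin> int ` generated_submonoid A}"
  have bound: "z < int c" if "z \<in> G" for z
  proof (rule ccontr)
    assume "\<not> z < int c"
    then have "nat z \<in> generated_submonoid A" "z = int (nat z)"
      by (auto intro: assms)
    then show False
      using that unfolding G_def by blast
  qed
  \<comment> \<open>All negative integers lie in \<open>G\<close>, so \<open>G\<close> is infinite;
    cutting it at -1 leaves a finite nonempty set with the same maximum.\<close>
  define H where "H = G \<inter> {-1..int c}"
  have "-1 \<in> H"
    by (auto simp: H_def G_def)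
  have "finite H"
    by (simp add: H_def)
  then have "Max H \<in> H"
    using \<open>-1 \<in> H\<close> by (auto intro: Max_in)
  then have "Max H \<in> G"
    by (simp add: H_def)
  have "z \<le> Max H" if "z \<in> G" for z
  proof (cases "z \<ge> -1")
    case True
    then have "z \<in> H"
      using that bound[OF that] by (simp add: H_def)
    then show ?thesis
      using \<open>finite H\<close> by simp
  next
    case False
    then show ?thesis
      using Max_ge[OF \<open>finite H\<close> \<open>-1 \<in> H\<close>] by linarith
  qed
  then have "frobenius_number A = Max H"
    unfolding frobenius_number_def using \<open>Max H \<in> G\<close>
    by (intro Greatest_equality) (auto simp: G_def)
  then show ?thesis
    using bound[OF \<open>Max H \<in> G\<close>] by simp
qed

lemma generated_submonoid_cong_le:
  assumes "w \<in> generated_submonoid A" "m \<in> A" "[w = n] (mod m)" "w \<le> n"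
  shows "n \<in> generated_submonoid A"
proof -
  obtain q where "n = w + q * m"
    using cong_sym[OF assms(3)] unfolding cong_le_nat[OF assms(4)]
    by (auto simp: add.commute)
  then show ?thesis
    using assms(1,2) by (auto intro: generated_submonoid.intros generated_submonoid_mult)
qed

text \<open>The block represents every residue class modulo \<open>m\<close>, so each
  \<open>n\<close> from \<open>c\<close> on is a block element plus a multiple of the generator
  \<open>m\<close>.\<close>

lemma frobenius_number_less_block:
  assumes "m \<in> A" "m > 0"
    and block: "\<And>j. j < m \<Longrightarrow> c + j \<in> generated_submonoid A"
  shows "frobenius_number A < int c"
proof (rule frobenius_number_less)
  fix n assume "n \<ge> c"
  have "c + (n - c) mod m \<in> generated_submonoid A"
    using block \<open>m > 0\<close> by simp
  moreover have "[c + (n - c) mod m = n] (mod m)"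
    using \<open>n \<ge> c\<close> by (simp add: cong_def mod_add_right_eq)
  moreover have "c + (n - c) mod m \<le> n"
    using \<open>n \<ge> c\<close> mod_less_eq_dividend[of "n - c" m] by linarith
  ultimately show "n \<in> generated_submonoid A"
    using \<open>m \<in> A\<close> generated_submonoid_cong_le by blast
qed

text \<open>In a sum of \<open>t\<close> copies of \<open>i\<close>, replacing \<open>j\<close> of
  them by \<open>i + 1\<close> raises the sum by \<open>j\<close>.\<close>

lemma consecutive_multiples_generated:
  assumes "i \<in> generated_submonoid A" "i + 1 \<in> generated_submonoid A" "j \<le> t"
  shows "t * i + j \<in> generated_submonoid A"
proof -
  have "(t - j) * i + j * (i + 1) \<in> generated_submonoid A"
    using assms by (auto intro: generated_submonoid.add generated_submonoid_mult simp del: mult_Suc_right)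
  also have "(t - j) * i + j * (i + 1) = ((t - j) + j) * i + j"
    by (simp add: algebra_simps)
  finally show ?thesis
    using assms(3) by simp
qed

lemma frobenius_number_less_consecutive:
  assumes "m \<in> A" "m > 0" "i \<in> generated_submonoid A" "i + 1 \<in> generated_submonoid A"
  shows "frobenius_number A < int ((m - 1) * i)"
proof (rule frobenius_number_less_block[OF assms(1,2)])
  fix j assume "j < m"
  then have "j \<le> m - 1"
    by simp
  then show "(m - 1) * i + j \<in> generated_submonoid A"
    by (rule consecutive_multiples_generated[OF assms(3,4)])
qed

section \<open>Schur's bound\<close>

text \<open>Bezout's identity needs negative coefficients, which a submonoid of the naturals does
  not offer; modulo \<open>m\<close> the factor \<open>m - 1\<close> serves as -1.\<close>

lemma Gcd_cong_generated:
  fixes A B :: "nat set"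
  assumes "finite B" "B \<subseteq> A" "m > 0"
  shows "\<exists>x\<in>generated_submonoid A. [x = Gcd B] (mod m)"
  using assms(1,2)
proof (induction B rule: finite_induct)
  case empty
  show ?case
    by (rule bexI[OF _ generated_submonoid.zero]) simp
next
  case (insert b B)
  then obtain x where x: "x \<in> generated_submonoid A" "[x = Gcd B] (mod m)"
    by auto
  show ?case
  proof (cases "b = 0")
    case True
    then show ?thesis
      using x by auto
  next
    case False
    then obtain u v where uv: "b * u = Gcd B * v + gcd b (Gcd B)"
      using bezout_nat by blast
    \<comment> \<open>This imitates \<open>u * b - v * Gcd B\<close>, with \<open>x\<close> in place
      of \<open>Gcd B\<close>.\<close>
    have "u * b + (v * (m - 1)) * x \<in> generated_submonoid A"
      using insert.prems x(1)
      by (auto intro: generated_submonoid.intros generated_submonoid_mult)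
    moreover have "[u * b + (v * (m - 1)) * x = gcd b (Gcd B)] (mod m)"
    proof -
      have "[u * b + (v * (m - 1)) * x = u * b + (v * (m - 1)) * Gcd B] (mod m)"
        by (intro cong_add cong_mult cong_refl x)
      also have "u * b + (v * (m - 1)) * Gcd B = gcd b (Gcd B) + (v * Gcd B) * (1 + (m - 1))"
        using uv by (simp only: algebra_simps mult_1_right)
      also have "[\<dots> = gcd b (Gcd B) + 0] (mod m)"
        using \<open>m > 0\<close> by (intro cong_add cong_refl) (simp add: cong_def)
      finally show ?thesis
        by simp
    qed
    ultimately show ?thesis
      by auto
  qed
qed

lemma small_generated_residue:
  fixes A :: "nat set"
  assumes "finite A" "m > 0" "Gcd A = 1" and le: "\<And>x. x \<in> A \<Longrightarrow> x \<le> d"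
  obtains w where "w \<in> generated_submonoid A" "[w = r] (mod m)" "w \<le> (m - 1) * d"
proof -
  \<comment> \<open>Sums of at most \<open>j\<close> generators are replaced by the size bound
    \<open>j * d\<close>; adding one generator still leads from level \<open>j\<close> to level
    \<open>Suc j\<close>.\<close>
  define R where "R j = {x mod m | x. x \<in> generated_submonoid A \<and> x \<le> j * d}" for j
  have R_sub: "R j \<subseteq> {..<m}" for j
    using \<open>m > 0\<close> by (auto simp: R_def)
  have R_mono: "R j \<subseteq> R (Suc j)" for j
    by (auto simp: R_def intro: trans_le_add2)
  \<comment> \<open>A stable \<open>R j\<close> is closed under adding generators, hence under
    adding any monoid element. Starting at 0 and adding \<open>r\<close> times an element congruent
    to 1 reaches each class \<open>r\<close>.\<close>
  have full: "R j = {..<m}" if stable: "R (Suc j) = R j" for j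
  proof -
    have step: "(t + a) mod m \<in> R j" if t: "t \<in> R j" and "a \<in> A" for t a
    proof -
      obtain x where "x \<in> generated_submonoid A" "x \<le> j * d" "t = x mod m"
        using t by (auto simp: R_def)
      then have "x + a \<in> generated_submonoid A" "x + a \<le> Suc j * d"
          "(t + a) mod m = (x + a) mod m"
        using le[OF \<open>a \<in> A\<close>] \<open>a \<in> A\<close>
        by (auto intro: generated_submonoid.intros simp: mod_simps)
      then have "(t + a) mod m \<in> R (Suc j)"
        unfolding R_def by blast
      then show ?thesis
        using stable by simp
    qed
    have closed: "\<forall>t\<in>R j. (t + x) mod m \<in> R j" if "x \<in> generated_submonoid A" for x
      using that
    proof induction
      case zero
      show ?case
        using R_sub[of j] by auto
    next
      case (gen x)
      then show ?case
        using step by blast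
    next
      case (add x y)
      show ?case
      proof
        fix t assume "t \<in> R j"
        then have "((t + x) mod m + y) mod m \<in> R j"
          using add.IH by blast
        then show "(t + (x + y)) mod m \<in> R j"
          by (simp add: mod_simps add.assoc)
      qed
    qed
    have "0 \<in> R j"
      using generated_submonoid.zero[of A] by (force simp: R_def)
    obtain x where x: "x \<in> generated_submonoid A" "[x = 1] (mod m)"
      using Gcd_cong_generated[of A A m] assms by auto
    have "r \<in> R j" if "r < m" for r
    proof -
      have "[r * x = r * 1] (mod m)"
        by (intro cong_mult cong_refl x)
      then have "(0 + r * x) mod m = r"
        using that by (simp add: cong_def)
      then show ?thesis
        using closed[OF generated_submonoid_mult[OF x(1)]] \<open>0 \<in> R j\<close> by metis
    qed
    then show ?thesis
      using R_sub by auto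
  qed
  have fin: "finite (R j)" for j
    using R_sub finite_subset by blast
  \<comment> \<open>The chain starts with the class of 0 and gains at least one class per level
    until it is full, so level \<open>m - 1\<close> contains all \<open>m\<close> classes.\<close>
  have card: "min m (Suc j) \<le> card (R j)" for j
  proof (induction j)
    case 0
    have "0 \<in> R 0"
      using generated_submonoid.zero[of A] by (force simp: R_def)
    then have "card (R 0) > 0"
      using fin by (auto simp: card_gt_0_iff)
    then show ?case
      by simp
  next
    case (Suc j)
    show ?case
    proof (cases "R (Suc j) = R j")
      case True
      then show ?thesis
        using full[OF True] by simp
    next
      case False
      then have "card (R j) < card (R (Suc j))"
        using R_mono fin by (intro psubset_card_mono) auto
      then show ?thesis
        using Suc.IH by simp
    qed
  qed
  have "R (m - 1) = {..<m}"
    using card[of "m - 1"] \<open>m > 0\<close> R_sub by (intro card_seteq) auto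
  then have "r mod m \<in> R (m - 1)"
    using \<open>m > 0\<close> by simp
  then show ?thesis
    using that by (auto simp: R_def cong_def)
qed

text \<open>The small representative \<open>w\<close> of the class of \<open>n\<close> exceeds
  \<open>n\<close> by at most \<open>m - 1\<close>, and a positive excess would be a multiple of
  \<open>m\<close>; hence \<open>w\<close> is at most \<open>n\<close>.\<close>

lemma frobenius_number_less_Schur:
  fixes A :: "nat set"
  assumes "finite A" "m \<in> A" "m > 0" "Gcd A = 1" "\<And>x. x \<in> A \<Longrightarrow> x \<le> d"
  shows "frobenius_number A < int ((m - 1) * (d - 1))"
proof (rule frobenius_number_less)
  fix n assume n: "n \<ge> (m - 1) * (d - 1)"
  obtain w where w: "w \<in> generated_submonoid A" "[w = n] (mod m)" "w \<le> (m - 1) * d"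
    using small_generated_residue[of A m d n] assms by auto
  have "d > 0"
    using assms by fastforce
  then have "(m - 1) * d = (m - 1) * (d - 1) + (m - 1)"
    by (cases d) auto
  then have "w < n + m"
    using w(3) n \<open>m > 0\<close> by linarith
  have "w \<le> n"
  proof (rule ccontr)
    assume "\<not> w \<le> n"
    then have "m dvd w - n"
      using w(2) cong_altdef_nat by (meson cong_sym nat_le_linear)
    then have "m \<le> w - n"
      using \<open>\<not> w \<le> n\<close> by (intro dvd_imp_le) auto
    then show False
      using \<open>w < n + m\<close> \<open>\<not> w \<le> n\<close> by linarith
  qed
  then show "n \<in> generated_submonoid A"
    using w(1,2) \<open>m \<in> A\<close> generated_submonoid_cong_le by blast
qed

section \<open>The three floor estimates\<close>

lemma floor_divide_le:
  fixes x c :: int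
  assumes "d > 0" "x < (c + 1) * int d"
  shows "\<lfloor>real_of_int x / real d\<rfloor> \<le> c"
proof -
  have "real_of_int x < real_of_int ((c + 1) * int d)"
    using assms(2) by (simp only: of_int_less_iff)
  then have "real_of_int x / real d < real_of_int c + 1"
    using assms(1) by (simp add: divide_less_eq)
  then show ?thesis
    by (simp add: floor_le_iff)
qed

theorem lemma4p3:
  fixes k d \<epsilon> :: nat and a :: "nat \<Rightarrow> nat" and A1 A2 :: "nat set" and F1 F2 :: int
  assumes "k \<ge> 3"
    and "a 0 = 0"
    and "strict_mono_on {0..k} a"
    and "a k = d"
    and "Gcd (a ` {1..k}) = 1"
    and "k < d"
    and "A1 = a ` {0..k}"
    and "A2 = {d - a i | i. i \<le> k}"
    and "F1 = frobenius_number (A1 - {0})"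
    and "F2 = frobenius_number (A2 - {0})"
    and "\<epsilon> = max (a 1) (d - a (k - 1))"
  shows "\<lfloor>real_of_int (F1 + F2) / real d\<rfloor> \<le> int (a 1) + (int d - int (a (k - 1))) - 3 \<and>
    ((\<exists>i \<le> d - 1. i \<in> A1 \<and> i + 1 \<in> A1) \<longrightarrow>
       \<lfloor>real_of_int (F1 + F2) / real d\<rfloor> \<le> int \<epsilon> - 2) \<and>
    ((\<exists>i \<le> d - \<epsilon> + 1. {i..i + \<epsilon> - 1} \<subseteq> A1) \<longrightarrow>
       \<lfloor>real_of_int (F1 + F2) / real d\<rfloor> \<le> 0)"
proof -
  have mono: "a i < a j" if "i < j" "j \<le> k" for i j
    using assms(3) that by (auto simp: strict_mono_on_def)
  have le_d: "a i \<le> d" if "i \<le> k" for i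
    using mono[of i k] that \<open>a k = d\<close> by (cases "i = k") auto
  define e where "e = d - a (k - 1)"
  have pos: "0 < a 1" "0 < e" "a (k - 1) < d" "0 < d"
    using mono[of 0 1] mono[of "k - 1" k] assms(1,2,4,6) by (auto simp: e_def)
  have A1: "A1 - {0} = a ` {1..k}"
  proof -
    have "a i \<noteq> 0" if "i \<in> {1..k}" for i
      using mono[of 0 i] that by auto
    then have "0 \<notin> a ` {1..k}"
      by force
    moreover have "{0..k} = insert 0 {1..k}"
      by auto
    then have "A1 = insert 0 (a ` {1..k})"
      using assms(2,7) by simp
    ultimately show ?thesis
      by blast
  qed
  \<comment> \<open>Only the index \<open>k\<close> yields 0, since \<open>a i < d\<close> for all
    smaller \<open>i\<close>.\<close>
  have A2: "A2 - {0} = (\<lambda>x. d - x) ` a ` {..<k}"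
  proof -
    have "A2 = insert (d - a k) ((\<lambda>x. d - x) ` a ` {..<k})"
      unfolding assms(8) by (force simp: le_less)
    moreover have "d - a i \<noteq> 0" if "i < k" for i
      using mono[of i k] that \<open>a k = d\<close> by auto
    then have "0 \<notin> (\<lambda>x. d - x) ` a ` {..<k}"
      by force
    ultimately show ?thesis
      using \<open>a k = d\<close> by auto
  qed
  have m1: "a 1 \<in> A1 - {0}"
    unfolding A1 using assms(1) by auto
  have m2: "e \<in> A2 - {0}"
    unfolding A2 e_def using assms(1) by auto
  have A1_gen: "x \<in> generated_submonoid (A1 - {0})" if "x \<in> A1" for x
    using that by (cases "x = 0") (auto intro: generated_submonoid.intros)
  have A2_gen: "d - x \<in> generated_submonoid (A2 - {0})" if "x \<in> A1" for x
  proof -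
    have "d - x \<in> A2"
      using that assms(7,8) by auto
    then show ?thesis
      by (cases "d - x = 0") (auto intro: generated_submonoid.intros)
  qed
  have A1_le: "x \<le> d" if "x \<in> A1" for x
    using that le_d assms(7) by auto
  have Gcd2: "Gcd (A2 - {0}) = 1"
  proof -
    define g where "g = Gcd (A2 - {0})"
    have "g dvd d - a i" if "i < k" for i
      unfolding g_def A2 using that by (intro Gcd_dvd) auto
    \<comment> \<open>Since \<open>a 0 = 0\<close>, the generator \<open>d\<close> itself lies in
      the reflected set; each \<open>a i\<close> is then the difference of \<open>d\<close> and
      \<open>d - a i\<close>.\<close>
    moreover from this[of 0] have "g dvd d"
      using assms(1,2) by simp
    ultimately have "g dvd a i" if "i \<le> k" for i
      using that le_d[OF that] \<open>a k = d\<close> by (metis dvd_diffD1 le_less)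
    then have "g dvd Gcd (a ` {1..k})"
      by (intro Gcd_greatest) auto
    then show ?thesis
      using assms(5) by (simp add: g_def)
  qed
  have part1: "F1 + F2 < (int (a 1) + int e - 2) * int d"
  proof -
    have "F1 < int ((a 1 - 1) * (d - 1))"
      unfolding assms(9) using m1 pos assms(5) A1_le
      by (intro frobenius_number_less_Schur) (auto simp: A1 intro: le_d)
    moreover have "F2 < int ((e - 1) * (d - 1))"
      unfolding assms(10) using m2 pos Gcd2
      by (intro frobenius_number_less_Schur) (auto simp: A2)
    moreover have "int ((x - 1) * (d - 1)) = (int x - 1) * (int d - 1)" if "x > 0" for x
      using that pos by (simp add: of_nat_diff)
    then have "int ((a 1 - 1) * (d - 1)) + int ((e - 1) * (d - 1))
        = (int (a 1) - 1) * (int d - 1) + (int e - 1) * (int d - 1)"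
      using pos by presburger
    then have "int ((a 1 - 1) * (d - 1)) + int ((e - 1) * (d - 1))
        = (int (a 1) + int e - 2) * (int d - 1)"
      by (simp only: algebra_simps)
    \<comment> \<open>The two Schur bounds add up to a multiple of \<open>d - 1\<close>; the factor
      is nonnegative because \<open>a 1\<close> and \<open>e\<close> are positive, so
      \<open>d - 1\<close> may be raised to \<open>d\<close>.\<close>
    moreover have "(int (a 1) + int e - 2) * (int d - 1) \<le> (int (a 1) + int e - 2) * int d"
      using pos by (intro mult_left_mono) auto
    ultimately show ?thesis
      by linarith
  qed
  have part2: "F1 + F2 < (int \<epsilon> - 1) * int d" if "i \<in> A1" "i + 1 \<in> A1" for i
  proof -
    have i: "i + 1 \<le> d"
      using A1_le that by blast
    have "F1 < int ((a 1 - 1) * i)"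
      unfolding assms(9) using m1 pos A1_gen that
      by (intro frobenius_number_less_consecutive) auto
    also have "\<dots> \<le> int ((\<epsilon> - 1) * i)"
      using assms(11) by (intro of_nat_mono mult_right_mono) auto
    finally have "F1 < (int \<epsilon> - 1) * int i"
      using assms(11) pos by (simp add: of_nat_diff)
    moreover have "F2 < (int \<epsilon> - 1) * (int d - int i - 1)"
    proof -
      \<comment> \<open>Reflection reverses the pair, so its smaller element is now
        \<open>d - (i + 1)\<close>.\<close>
      have "d - (i + 1) + 1 = d - i"
        using i by simp
      then have "F2 < int ((e - 1) * (d - (i + 1)))"
        unfolding assms(10) using m2 pos A2_gen[OF that(1)] A2_gen[OF that(2)]
        by (intro frobenius_number_less_consecutive) auto
      also have "\<dots> \<le> int ((\<epsilon> - 1) * (d - (i + 1)))"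
        using assms(11) by (intro of_nat_mono mult_right_mono) (auto simp: e_def)
      also have "\<dots> = (int \<epsilon> - 1) * (int d - int i - 1)"
        using assms(11) pos i by (simp add: of_nat_diff)
      finally show ?thesis .
    qed
    \<comment> \<open>The smaller elements of the two pairs sum to \<open>d - 1\<close>, which
      leaves \<open>\<epsilon> - 1\<close> to spare.\<close>
    moreover have "(int \<epsilon> - 1) * int i + (int \<epsilon> - 1) * (int d - int i - 1)
        = (int \<epsilon> - 1) * int d - (int \<epsilon> - 1)"
      by (simp add: algebra_simps)
    ultimately show ?thesis
      using assms(11) pos by linarith
  qed
  have part3: "F1 + F2 < int d" if block: "{i..i + \<epsilon> - 1} \<subseteq> A1" for i
  proof -
    have eps: "a 1 \<le> \<epsilon>" "e \<le> \<epsilon>"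
      using assms(11) by (auto simp: e_def)
    have "i + \<epsilon> - 1 \<in> {i..i + \<epsilon> - 1}"
      using eps pos by auto
    then have top: "i + \<epsilon> - 1 \<le> d"
      using A1_le block by blast
    have "F1 < int i"
      unfolding assms(9)
    proof (rule frobenius_number_less_block[OF m1 pos(1)])
      fix j assume "j < a 1"
      then have "i + j \<in> {i..i + \<epsilon> - 1}"
        using eps by auto
      then show "i + j \<in> generated_submonoid (A1 - {0})"
        using A1_gen block by blast
    qed
    moreover have "F2 < int (d - (i + \<epsilon> - 1))"
      unfolding assms(10)
    proof (rule frobenius_number_less_block[OF m2 pos(2)])
      fix j assume "j < e"
      \<comment> \<open>The reflected block is counted upwards from the image of the top element
        \<open>i + \<epsilon> - 1\<close>. Its start and \<open>i\<close> sum to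
        \<open>d - \<epsilon> + 1\<close>, which is at most \<open>d\<close>.\<close>
      then have "i + \<epsilon> - 1 - j \<in> {i..i + \<epsilon> - 1}"
        and "d - (i + \<epsilon> - 1 - j) = d - (i + \<epsilon> - 1) + j"
        using eps top by auto
      then show "d - (i + \<epsilon> - 1) + j \<in> generated_submonoid (A2 - {0})"
        using A2_gen block by (metis subsetD)
    qed
    ultimately show ?thesis
      using eps pos top by linarith
  qed
  show ?thesis
  proof (intro conjI impI)
    have "int (a 1) + (int d - int (a (k - 1))) - 3 + 1 = int (a 1) + int e - 2"
      using pos by (simp add: e_def of_nat_diff)
    then show "\<lfloor>real_of_int (F1 + F2) / real d\<rfloor> \<le> int (a 1) + (int d - int (a (k - 1))) - 3"
      using pos part1 by (intro floor_divide_le) simp_all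
  next
    assume "\<exists>i \<le> d - 1. i \<in> A1 \<and> i + 1 \<in> A1"
    then have "F1 + F2 < (int \<epsilon> - 2 + 1) * int d"
      using part2 by auto
    then show "\<lfloor>real_of_int (F1 + F2) / real d\<rfloor> \<le> int \<epsilon> - 2"
      using pos by (intro floor_divide_le)
  next
    assume "\<exists>i \<le> d - \<epsilon> + 1. {i..i + \<epsilon> - 1} \<subseteq> A1"
    then have "F1 + F2 < (0 + 1) * int d"
      using part3 by auto
    then show "\<lfloor>real_of_int (F1 + F2) / real d\<rfloor> \<le> 0"
      using pos by (intro floor_divide_le)
  qed
qed

end
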